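(* Let $n\ge2$ and suppose that $M$ is a commutator monomial of the variables $X_1,\ldots,X_n$, each occurring with multiplicity $1$. Then \[\delta^{\mathrm L}_n(M)=\frac1n\sum_{k=1}^n \mathrm{cw}_{X_k}(M)\;X_k\otimes \mathrm{rem}^{\mathrm L}_{X_k}(M).\]
   Context: The coefficient ring $K$ is commutative with $\mathbb Q\subset K$. The free Lie algebra $\mathrm F^{\mathrm{Lie}}[X_\lambda:\lambda\in\Lambda]$ over $K$ is identified with the commutator Lie subalgebra of the free associative algebra $\mathrm F[X_\lambda:\lambda\in\Lambda]$ generated by the $X_\lambda$; a subscript $(n)$ denotes the homogeneous part of degree $n$. For $n\ge2$ and $P\in\mathrm F^{\mathrm{Lie}}[X_\lambda:\lambda\in\Lambda]_{(n)}$ with associative expansion $P=\sum_{(\lambda_1,\ldots,\lambda_n)\in\Lambda^n}c_{(\lambda_1,\ldots,\lambda_n)}X_{\lambda_1}\cdots X_{\lambda_n}$, one defines \[\delta^{\mathrm L}_n(P)=\frac1n\sum_{(\lambda_1,\ldots,\lambda_n)}c_{(\lambda_1,\ldots,\lambda_n)}\,X_{\lambda_1}\otimes[X_{\lambda_2},\ldots,[X_{\lambda_{n-1}},X_{\lambda_n}]\ldots]\ \in\ \mathrm F^{\mathrm{Lie}}[X_\lambda]_{(1)}\otimes\mathrm F^{\mathrm{Lie}}[X_\lambda]_{(n-1)}\] (for $n=2$ the second factor is $X_{\lambda_2}$). A commutator monomial is an iterated commutator expression of the variables, possibly multiplied by $-1$ (in degree 1: $\pm X_\lambda$); $\deg$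 is its total degree. Let $M=\pm[M_1,M_2]$ be a commutator monomial in which every variable has multiplicity $1$ (such $M$ can be written in a unique way up to switches in the commutators and corresponding sign changes). The co-weight of a variable $X_k$ of $M$ is \[\mathrm{cw}_{X_k}(M)=\deg M_2\ \text{ if } X_k \text{ is a variable of } M_1,\qquad \mathrm{cw}_{X_k}(M)=\deg M_1\ \text{ if } X_k\text{ is a variable of } M_2.\] By switching entries of commutators one can write $M=(-1)^l[[\ldots[[X_k,N_1],N_2],\ldots,N_{s-1}],N_s]$ with commutator monomials $N_1,\ldots,N_s$, and then \[\mathrm{rem}^{\mathrm L}_{X_k}(M)=(-1)^l[N_1,[N_2,\ldots[N_{s-1},N_s]\ldots]]\] (equal to $(-1)^lN_1$ if $s=1$). *)

theory Defs
  imports Complex_Main "HOL-Library.Poly_Mapping" "HOL-Library.Multiset"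
begin

section \<open>The coefficient ring\<close>

text \<open>\<open>\<rat> \<subseteq> K\<close>: the embedding is carried along explicitly; it supplies scalars such as \<open>1/n\<close> in \<open>K\<close>.\<close>

definition rat_embedding :: "(rat \<Rightarrow> 'k::comm_ring_1) \<Rightarrow> bool" where
  "rat_embedding \<iota> \<longleftrightarrow> inj \<iota> \<and> \<iota> 1 = 1 \<and>
     (\<forall>a b. \<iota> (a + b) = \<iota> a + \<iota> b) \<and> (\<forall>a b. \<iota> (a * b) = \<iota> a * \<iota> b)"


section \<open>Free modules and the free associative algebra\<close>

text \<open>\<open>'i \<Rightarrow>\<^sub>0 'k\<close> is the free \<open>K\<close>-module on the index type \<open>'i\<close>.\<close>

definition scale :: "'k::comm_ring_1 \<Rightarrow> ('i \<Rightarrow>\<^sub>0 'k) \<Rightarrow> ('i \<Rightarrow>\<^sub>0 'k)" where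
  "scale c p = Poly_Mapping.map (\<lambda>x. c * x) p"

lemma lookup_scale [simp]: "Poly_Mapping.lookup (scale c p) i = c * Poly_Mapping.lookup p i"
  unfolding scale_def by transfer (simp add: when_def)

interpretation free_mod: module scale
  by unfold_locales (auto intro!: poly_mapping_eqI simp: lookup_add algebra_simps)

text \<open>
  Words form the free monoid under concatenation, so that the convolution product of
  \<^theory>\<open>HOL-Library.Poly_Mapping\<close> makes \<open>'v list \<Rightarrow>\<^sub>0 'k\<close> the free associative algebra on
  variables indexed by \<open>'v\<close>; \<open>lookup P w\<close> is the coefficient of the word \<open>w\<close> in \<open>P\<close>.
\<close>

instantiation list :: (type) monoid_add
begin
definition zero_list :: "'a list" where "zero_list = []"
definition plus_list :: "'a list \<Rightarrow> 'a list \<Rightarrow> 'a list" where "plus_list u v = u @ v"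
instance by standard (simp_all add: zero_list_def plus_list_def)
end

type_synonym ('v, 'k) free_alg = "'v list \<Rightarrow>\<^sub>0 'k"

definition X :: "'v \<Rightarrow> ('v, 'k::comm_ring_1) free_alg" where
  "X v = Poly_Mapping.single [v] 1"

definition bracket ::
    "('v, 'k::comm_ring_1) free_alg \<Rightarrow> ('v, 'k) free_alg \<Rightarrow> ('v, 'k) free_alg" where
  "bracket P Q = P * Q - Q * P"

inductive_set free_lie :: "'v set \<Rightarrow> ('v, 'k::comm_ring_1) free_alg set" for \<Lambda> where
  gen: "v \<in> \<Lambda> \<Longrightarrow> X v \<in> free_lie \<Lambda>"
| zero: "0 \<in> free_lie \<Lambda>"
| add: "P \<in> free_lie \<Lambda> \<Longrightarrow> Q \<in> free_lie \<Lambda> \<Longrightarrow> P + Q \<in> free_lie \<Lambda>"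
| scale: "P \<in> free_lie \<Lambda> \<Longrightarrow> scale c P \<in> free_lie \<Lambda>"
| bracket: "P \<in> free_lie \<Lambda> \<Longrightarrow> Q \<in> free_lie \<Lambda> \<Longrightarrow> bracket P Q \<in> free_lie \<Lambda>"

definition free_lie_part :: "'v set \<Rightarrow> nat \<Rightarrow> ('v, 'k::comm_ring_1) free_alg set" where
  "free_lie_part \<Lambda> n = {P \<in> free_lie \<Lambda>. \<forall>w \<in> Poly_Mapping.keys P. length w = n}"


section \<open>Tensor products\<close>

text \<open>
  \<open>A \<otimes>\<^sub>K B\<close> for submodules \<open>A\<close>, \<open>B\<close> of free modules is constructed in the usual way: the free module
  on \<open>A \<times> B\<close> modulo the bilinearity relations. \<open>pure a b\<close> is the free generator at \<open>(a, b)\<close>; its class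
  is \<open>a \<otimes> b\<close>, so the class of a linear combination of generators is the corresponding
  linear combination of pure tensors.
\<close>

type_synonym ('i, 'j, 'k) formal_tensor = "(('i \<Rightarrow>\<^sub>0 'k) \<times> ('j \<Rightarrow>\<^sub>0 'k)) \<Rightarrow>\<^sub>0 'k"

definition pure :: "('i \<Rightarrow>\<^sub>0 'k::comm_ring_1) \<Rightarrow> ('j \<Rightarrow>\<^sub>0 'k) \<Rightarrow> ('i, 'j, 'k) formal_tensor" where
  "pure a b = Poly_Mapping.single (a, b) 1"

definition tensor_relations ::
    "('i \<Rightarrow>\<^sub>0 'k::comm_ring_1) set \<Rightarrow> ('j \<Rightarrow>\<^sub>0 'k) set \<Rightarrow> ('i, 'j, 'k) formal_tensor set" where
  "tensor_relations A B = free_mod.span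
     ({pure (a + a') b - pure a b - pure a' b | a a' b. a \<in> A \<and> a' \<in> A \<and> b \<in> B} \<union>
      {pure a (b + b') - pure a b - pure a b' | a b b'. a \<in> A \<and> b \<in> B \<and> b' \<in> B} \<union>
      {pure (scale c a) b - scale c (pure a b) | c a b. a \<in> A \<and> b \<in> B} \<union>
      {pure a (scale c b) - scale c (pure a b) | c a b. a \<in> A \<and> b \<in> B})"

definition tensor_congruence ::
    "('i \<Rightarrow>\<^sub>0 'k::comm_ring_1) set \<Rightarrow> ('j \<Rightarrow>\<^sub>0 'k) set \<Rightarrow>
     (('i, 'j, 'k) formal_tensor \<times> ('i, 'j, 'k) formal_tensor) set" where
  "tensor_congruence A B =
     {(f, g). Poly_Mapping.keys f \<subseteq> A \<times> B \<and> Poly_Mapping.keys g \<subseteq> A \<times> B \<and> f - g \<in> tensor_relations A B}"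

definition tensor_product ::
    "('i \<Rightarrow>\<^sub>0 'k::comm_ring_1) set \<Rightarrow> ('j \<Rightarrow>\<^sub>0 'k) set \<Rightarrow> ('i, 'j, 'k) formal_tensor set set" where
  "tensor_product A B = {f. Poly_Mapping.keys f \<subseteq> A \<times> B} // tensor_congruence A B"

definition tensor_class ::
    "('i \<Rightarrow>\<^sub>0 'k::comm_ring_1) set \<Rightarrow> ('j \<Rightarrow>\<^sub>0 'k) set \<Rightarrow>
     ('i, 'j, 'k) formal_tensor \<Rightarrow> ('i, 'j, 'k) formal_tensor set" where
  "tensor_class A B f = tensor_congruence A B `` {f}"


section \<open>Commutator monomials\<close>

datatype 'v cmon = Var 'v | Neg "'v cmon" | Comm "'v cmon" "'v cmon"

primrec cval :: "'v cmon \<Rightarrow> ('v, 'k::comm_ring_1) free_alg" where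
  "cval (Var v) = X v"
| "cval (Neg M) = - cval M"
| "cval (Comm M N) = bracket (cval M) (cval N)"

primrec var_mset :: "'v cmon \<Rightarrow> 'v multiset" where
  "var_mset (Var v) = {#v#}"
| "var_mset (Neg M) = var_mset M"
| "var_mset (Comm M N) = var_mset M + var_mset N"

abbreviation cdeg :: "'v cmon \<Rightarrow> nat" where
  "cdeg M \<equiv> size (var_mset M)"

text \<open>Co-weight of the variable \<open>v\<close>; only meaningful in degree at least 2 and if \<open>v\<close> has multiplicity 1.\<close>

primrec cw :: "'v \<Rightarrow> 'v cmon \<Rightarrow> nat" where
  "cw v (Var u) = 0"
| "cw v (Neg M) = cw v M"
| "cw v (Comm M N) = (if v \<in># var_mset M then cdeg N else cdeg M)"

text \<open>Rewriting by switching entries of commutators, with the corresponding sign changes.\<close>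

inductive switch_eq :: "'v cmon \<Rightarrow> 'v cmon \<Rightarrow> bool" where
  switch: "switch_eq (Comm M N) (Neg (Comm N M))"
| neg_neg: "switch_eq (Neg (Neg M)) M"
| neg_left: "switch_eq (Comm (Neg M) N) (Neg (Comm M N))"
| neg_right: "switch_eq (Comm M (Neg N)) (Neg (Comm M N))"
| refl: "switch_eq M M"
| sym: "switch_eq M N \<Longrightarrow> switch_eq N M"
| trans: "switch_eq L M \<Longrightarrow> switch_eq M N \<Longrightarrow> switch_eq L N"
| cong_Neg: "switch_eq M M' \<Longrightarrow> switch_eq (Neg M) (Neg M')"
| cong_Comm: "switch_eq M M' \<Longrightarrow> switch_eq N N' \<Longrightarrow> switch_eq (Comm M N) (Comm M' N')"

text \<open>\<open>left_nest L [N\<^sub>1, \<dots>, N\<^sub>s] = [[\<dots>[L, N\<^sub>1], \<dots>], N\<^sub>s]\<close> and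
  \<open>right_nest [N\<^sub>1, \<dots>, N\<^sub>s] = [N\<^sub>1, [N\<^sub>2, \<dots>[N\<^sub>s\<^sub>-\<^sub>1, N\<^sub>s]\<dots>]]\<close>.\<close>

definition left_nest :: "'v cmon \<Rightarrow> 'v cmon list \<Rightarrow> 'v cmon" where
  "left_nest L Ns = foldl Comm L Ns"

fun right_nest :: "'v cmon list \<Rightarrow> 'v cmon" where
  "right_nest [N] = N"
| "right_nest (N # N' # Ns) = Comm N (right_nest (N' # Ns))"

text \<open>
  If \<open>M\<close> has degree at least 2 and \<open>v\<close> has multiplicity 1 in \<open>M\<close>, then such \<open>l\<close> and \<open>Ns\<close> exist
  (lemma \<open>remL_witness\<close>) and the value does not depend on their choice (lemma \<open>remL_eqI\<close>).
\<close>

definition remL :: "'v \<Rightarrow> 'v cmon \<Rightarrow> ('v, 'k::comm_ring_1) free_alg" where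
  "remL v M = (THE R. \<exists>l Ns. Ns \<noteq> [] \<and> switch_eq M ((Neg ^^ l) (left_nest (Var v) Ns)) \<and>
                 R = cval ((Neg ^^ l) (right_nest Ns)))"

text \<open>
  Well-definedness of \<^const>\<open>remL\<close>: with \<open>M\<close> rewritten as \<open>(-1)\<^sup>l[[\<dots>[X\<^sub>v, N\<^sub>1], \<dots>], N\<^sub>s]\<close>,
  \<open>rem_tail v M\<close> is the map \<open>Y \<mapsto> (-1)\<^sup>l[N\<^sub>1, [\<dots>, [N\<^sub>s, Y]\<dots>]]\<close>, which, unlike \<^const>\<open>remL\<close>,
  can be computed recursively, and \<open>rem_rec v M\<close> is the resulting value of \<open>remL v M\<close>.
\<close>

primrec rem_tail :: "'v \<Rightarrow> 'v cmon \<Rightarrow> ('v, 'k::comm_ring_1) free_alg \<Rightarrow> ('v, 'k) free_alg" where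
  "rem_tail v (Var u) Y = Y"
| "rem_tail v (Neg M) Y = - rem_tail v M Y"
| "rem_tail v (Comm M N) Y =
     (if v \<in># var_mset M then rem_tail v M (bracket (cval N) Y)
      else - rem_tail v N (bracket (cval M) Y))"

primrec rem_rec :: "'v \<Rightarrow> 'v cmon \<Rightarrow> ('v, 'k::comm_ring_1) free_alg" where
  "rem_rec v (Var u) = 0"
| "rem_rec v (Neg M) = - rem_rec v M"
| "rem_rec v (Comm M N) =
     (if v \<in># var_mset M then rem_tail v M (cval N) else - rem_tail v N (cval M))"

lemma bracket_minus: "bracket (- P) Q = - bracket P Q" "bracket P (- Q) = - bracket P Q"
  and bracket_switch: "bracket Q P = - bracket P Q"
  by (simp_all add: bracket_def)

lemma rem_tail_minus: "rem_tail v M (- Y) = - rem_tail v M Y"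
  by (induction M arbitrary: Y) (simp_all add: bracket_minus)

lemma switch_eq_var_mset: "switch_eq M N \<Longrightarrow> var_mset M = var_mset N"
  by (induction rule: switch_eq.induct) simp_all

lemma switch_eq_cval: "switch_eq M N \<Longrightarrow> cval M = cval N"
  by (induction rule: switch_eq.induct) (simp_all add: bracket_minus bracket_switch[symmetric])

lemma switch_eq_rem_tail:
  "switch_eq M N \<Longrightarrow> count (var_mset M) v = 1 \<Longrightarrow> rem_tail v M Y = rem_tail v N Y"
proof (induction arbitrary: Y rule: switch_eq.induct)
  case (cong_Comm M M' N N')
  note eqs = switch_eq_var_mset[OF cong_Comm.hyps(1)] switch_eq_var_mset[OF cong_Comm.hyps(2)]
    switch_eq_cval[OF cong_Comm.hyps(1)] switch_eq_cval[OF cong_Comm.hyps(2)]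
  show ?case
  proof (cases "v \<in># var_mset M")
    case True
    then have "count (var_mset M) v = 1"
      using cong_Comm.prems by (simp flip: count_greater_zero_iff)
    then show ?thesis using True eqs(1,2) by (simp add: cong_Comm.IH(1) eqs(3,4))
  next
    case False
    then have "count (var_mset N) v = 1"
      using cong_Comm.prems by (simp add: not_in_iff)
    then show ?thesis using False eqs(1,2) by (simp add: cong_Comm.IH(2) eqs(3,4))
  qed
qed (auto simp: bracket_minus rem_tail_minus not_in_iff switch_eq_var_mset
          simp flip: count_greater_zero_iff)

lemma switch_eq_rem_rec:
  "switch_eq M N \<Longrightarrow> count (var_mset M) v = 1 \<Longrightarrow> rem_rec v M = rem_rec v N"
proof (induction rule: switch_eq.induct)
  case (cong_Comm M M' N N')
  note eqs = switch_eq_var_mset[OF cong_Comm.hyps(1)] switch_eq_var_mset[OF cong_Comm.hyps(2)]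
    switch_eq_cval[OF cong_Comm.hyps(1)] switch_eq_cval[OF cong_Comm.hyps(2)]
  show ?case
  proof (cases "v \<in># var_mset M")
    case True
    then have "count (var_mset M) v = 1"
      using cong_Comm.prems by (simp flip: count_greater_zero_iff)
    then show ?thesis using True eqs(1,2)
      by (simp add: switch_eq_rem_tail[OF cong_Comm.hyps(1)] eqs(3,4))
  next
    case False
    then have "count (var_mset N) v = 1"
      using cong_Comm.prems by (simp add: not_in_iff)
    then show ?thesis using False eqs(1,2)
      by (simp add: switch_eq_rem_tail[OF cong_Comm.hyps(2)] eqs(3,4))
  qed
qed (auto simp: bracket_minus rem_tail_minus not_in_iff switch_eq_var_mset
          simp flip: count_greater_zero_iff)

lemma left_nest_snoc: "left_nest L (Ns @ [N]) = Comm (left_nest L Ns) N"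
  by (simp add: left_nest_def)

lemma var_left_nest: "v \<in># var_mset (left_nest (Var v) Ns)"
  by (induction Ns rule: rev_induct) (simp_all add: left_nest_snoc, simp add: left_nest_def)

lemma right_nest_Cons: "Ns \<noteq> [] \<Longrightarrow> right_nest (N # Ns) = Comm N (right_nest Ns)"
  by (cases Ns) simp_all

lemma rem_tail_left_nest:
  "rem_tail v (left_nest (Var v) Ns) (cval N) = cval (right_nest (Ns @ [N]))"
proof (induction Ns arbitrary: N rule: rev_induct)
  case Nil
  then show ?case by (simp add: left_nest_def)
next
  case (snoc N' Ns)
  have "cval (right_nest (Ns @ [Comm N' N])) = cval (right_nest (Ns @ [N', N]))"
    by (induction Ns) (simp_all add: right_nest_Cons)
  then show ?case
    using snoc.IH[of "Comm N' N"] by (simp add: left_nest_snoc var_left_nest)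
qed

lemma rem_rec_left_nest:
  "Ns \<noteq> [] \<Longrightarrow> rem_rec v ((Neg ^^ l) (left_nest (Var v) Ns)) = cval ((Neg ^^ l) (right_nest Ns))"
proof (induction l)
  case 0
  then show ?case
    by (cases Ns rule: rev_cases) (simp_all add: left_nest_snoc var_left_nest rem_tail_left_nest)
qed simp

lemma switch_eq_Neg_pow_Comm:
  "switch_eq (Comm ((Neg ^^ l) M) N) ((Neg ^^ l) (Comm M N))"
proof (induction l)
  case 0
  then show ?case by (simp add: switch_eq.refl)
next
  case (Suc l)
  then show ?case
    by (auto intro: switch_eq.trans[OF switch_eq.neg_left] switch_eq.cong_Neg)
qed

lemma left_nest_exists:
  "v \<in># var_mset M \<Longrightarrow> \<exists>l Ns. switch_eq M ((Neg ^^ l) (left_nest (Var v) Ns))"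
proof (induction M)
  case (Var u)
  then have "switch_eq (Var u) ((Neg ^^ 0) (left_nest (Var v) []))"
    by (simp add: left_nest_def switch_eq.refl)
  then show ?case by blast
next
  case (Neg M)
  then obtain l Ns where "switch_eq M ((Neg ^^ l) (left_nest (Var v) Ns))" by auto
  then have "switch_eq (Neg M) ((Neg ^^ Suc l) (left_nest (Var v) Ns))"
    by (simp add: switch_eq.cong_Neg)
  then show ?case by blast
next
  case (Comm M N)
  have *: "\<exists>l Ns. switch_eq (Comm M' N') ((Neg ^^ l) (left_nest (Var v) Ns))"
    if "switch_eq M' ((Neg ^^ l) (left_nest (Var v) Ns))" for M' N' l Ns
  proof -
    have "switch_eq (Comm M' N') ((Neg ^^ l) (left_nest (Var v) (Ns @ [N'])))"
      unfolding left_nest_snoc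
      by (rule switch_eq.trans[OF switch_eq.cong_Comm[OF that switch_eq.refl]
            switch_eq_Neg_pow_Comm])
    then show ?thesis by blast
  qed
  show ?case
  proof (cases "v \<in># var_mset M")
    case True
    then show ?thesis using Comm.IH(1) * by blast
  next
    case False
    then obtain l Ns where "switch_eq (Comm N M) ((Neg ^^ l) (left_nest (Var v) Ns))"
      using Comm.prems Comm.IH(2) * by fastforce
    then have "switch_eq (Comm M N) ((Neg ^^ Suc l) (left_nest (Var v) Ns))"
      by (auto intro: switch_eq.trans[OF switch_eq.switch] switch_eq.cong_Neg)
    then show ?thesis by blast
  qed
qed

lemma remL_eqI:
  assumes "count (var_mset M) v = 1" "Ns \<noteq> []"
    and "switch_eq M ((Neg ^^ l) (left_nest (Var v) Ns))"
  shows "remL v M = cval ((Neg ^^ l) (right_nest Ns))"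
  unfolding remL_def
proof (rule the_equality)
  show "\<exists>l' Ns'. Ns' \<noteq> [] \<and> switch_eq M ((Neg ^^ l') (left_nest (Var v) Ns')) \<and>
    cval ((Neg ^^ l) (right_nest Ns)) = cval ((Neg ^^ l') (right_nest Ns'))"
    using assms by blast
next
  fix R :: "('a, 'b) free_alg"
  assume "\<exists>l' Ns'. Ns' \<noteq> [] \<and> switch_eq M ((Neg ^^ l') (left_nest (Var v) Ns')) \<and>
    R = cval ((Neg ^^ l') (right_nest Ns'))"
  then have "R = rem_rec v M"
    using assms(1) switch_eq_rem_rec rem_rec_left_nest by metis
  also have "\<dots> = cval ((Neg ^^ l) (right_nest Ns))"
    by (simp add: switch_eq_rem_rec[OF assms(3,1)] rem_rec_left_nest[OF assms(2)])
  finally show "R = cval ((Neg ^^ l) (right_nest Ns))" .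
qed

lemma remL_witness:
  assumes "count (var_mset M) v = 1" "cdeg M \<ge> 2"
  obtains l Ns where "Ns \<noteq> []" "switch_eq M ((Neg ^^ l) (left_nest (Var v) Ns))"
proof -
  have "v \<in># var_mset M" using assms(1) by (simp flip: count_greater_zero_iff)
  from left_nest_exists[OF this] obtain l Ns
    where *: "switch_eq M ((Neg ^^ l) (left_nest (Var v) Ns))" by blast
  have pow: "var_mset ((Neg ^^ l) L) = var_mset L" for L :: "'a cmon"
    by (induction l) simp_all
  have "Ns \<noteq> []"
  proof
    assume "Ns = []"
    then have "cdeg M = 1" using switch_eq_var_mset[OF *] by (simp add: pow left_nest_def)
    then show False using assms(2) by simp
  qed
  then show thesis using that * by blast
qed


section \<open>The map \<open>\<delta>\<^sup>L\<^sub>n\<close>\<close>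

text \<open>Only words with non-zero coefficient contribute to the sum.\<close>

definition deltaL ::
    "'v set \<Rightarrow> (rat \<Rightarrow> 'k::comm_ring_1) \<Rightarrow> nat \<Rightarrow> ('v, 'k) free_alg \<Rightarrow>
     ('v list, 'v list, 'k) formal_tensor set" where
  "deltaL \<Lambda> \<iota> n P = tensor_class (free_lie_part \<Lambda> 1) (free_lie_part \<Lambda> (n - 1))
     (scale (\<iota> (1 / of_nat n))
       (\<Sum>w \<in> Poly_Mapping.keys P. scale (Poly_Mapping.lookup P w) (pure (X (hd w)) (cval (right_nest (map Var (tl w)))))))"

text \<open>The definitions have the expected codomains.\<close>

lemma bracket_keys:
  fixes P Q :: "('v, 'k::comm_ring_1) free_alg"
  assumes "w \<in> Poly_Mapping.keys (bracket P Q)"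
  obtains u v where "w = u @ v \<or> w = v @ u" "u \<in> Poly_Mapping.keys P" "v \<in> Poly_Mapping.keys Q"
proof -
  have "w \<in> Poly_Mapping.keys (P * Q) \<or> w \<in> Poly_Mapping.keys (Q * P)"
    using assms keys_diff[of "P * Q" "Q * P"] unfolding bracket_def by blast
  then show thesis
  proof
    assume "w \<in> Poly_Mapping.keys (P * Q)"
    then obtain u v where "w = u + v" "u \<in> Poly_Mapping.keys P" "v \<in> Poly_Mapping.keys Q"
      using keys_mult[of P Q] by blast
    then show thesis using that unfolding plus_list_def by blast
  next
    assume "w \<in> Poly_Mapping.keys (Q * P)"
    then obtain u v where "w = v + u" "u \<in> Poly_Mapping.keys P" "v \<in> Poly_Mapping.keys Q"
      using keys_mult[of Q P] by blast
    then show thesis using that unfolding plus_list_def by blast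
  qed
qed

lemma free_lie_uminus:
  fixes P :: "('v, 'k::comm_ring_1) free_alg"
  shows "P \<in> free_lie \<Lambda> \<Longrightarrow> - P \<in> free_lie \<Lambda>"
  using free_lie.scale[of P \<Lambda> "-1"] by (simp add: free_mod.scale_minus_left)

lemma cval_in_free_lie_part:
  "set_mset (var_mset M) \<subseteq> \<Lambda> \<Longrightarrow>
    (cval M :: ('v, 'k::comm_ring_1) free_alg) \<in> free_lie_part \<Lambda> (cdeg M)"
proof (induction M)
  case (Var v)
  then show ?case by (auto simp: free_lie_part_def X_def intro: free_lie.gen[unfolded X_def])
next
  case (Neg M)
  then show ?case by (auto simp: free_lie_part_def free_lie_uminus)
next
  case (Comm M N)
  then have MN: "(cval M :: ('v, 'k) free_alg) \<in> free_lie_part \<Lambda> (cdeg M)"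
    "(cval N :: ('v, 'k) free_alg) \<in> free_lie_part \<Lambda> (cdeg N)" by simp_all
  have "length w = cdeg M + cdeg N"
    if w: "w \<in> Poly_Mapping.keys (bracket (cval M) (cval N) :: ('v, 'k) free_alg)" for w
    using w by (rule bracket_keys) (use MN in \<open>auto simp: free_lie_part_def\<close>)
  then show ?case using MN by (auto simp: free_lie_part_def intro: free_lie.bracket)
qed

lemma var_mset_right_nest:
  "vs \<noteq> [] \<Longrightarrow> var_mset (right_nest (map Var vs)) = mset vs"
  by (induction vs rule: induct_list012) auto

lemma free_lie_words:
  "P \<in> free_lie \<Lambda> \<Longrightarrow> w \<in> Poly_Mapping.keys P \<Longrightarrow> set w \<subseteq> \<Lambda>"
proof (induction arbitrary: w rule: free_lie.induct)
  case (gen v)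
  then show ?case by (auto simp: X_def split: if_splits)
next
  case (add P Q)
  then show ?case using Poly_Mapping.keys_add[of P Q] by blast
next
  case (scale P c)
  then have "w \<in> Poly_Mapping.keys P" by (auto simp: in_keys_iff)
  then show ?case using scale by blast
next
  case (bracket P Q)
  from bracket.prems obtain u v where "w = u @ v \<or> w = v @ u"
    "u \<in> Poly_Mapping.keys P" "v \<in> Poly_Mapping.keys Q" by (rule bracket_keys)
  then show ?case using bracket.IH by (metis set_append Un_least)
qed auto

lemma keys_scale: "Poly_Mapping.keys (scale c p) \<subseteq> Poly_Mapping.keys p"
  by (auto simp: in_keys_iff)

lemma deltaL_in_tensor_product:
  assumes "P \<in> free_lie_part \<Lambda> n" "n \<ge> 2"
  shows "deltaL \<Lambda> \<iota> n P \<in> tensor_product (free_lie_part \<Lambda> 1) (free_lie_part \<Lambda> (n - 1))"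
proof -
  let ?t = "\<lambda>w. cval (right_nest (map Var (tl w))) :: ('a, 'b) free_alg"
  let ?f = "\<lambda>w. scale (Poly_Mapping.lookup P w) (pure (X (hd w)) (?t w))"
  have "Poly_Mapping.keys (?f w) \<subseteq> free_lie_part \<Lambda> 1 \<times> free_lie_part \<Lambda> (n - 1)"
    if w: "w \<in> Poly_Mapping.keys P" for w
  proof -
    have "length w = n" "set w \<subseteq> \<Lambda>"
      using w assms free_lie_words[of P \<Lambda> w] by (auto simp: free_lie_part_def)
    then obtain v vs where *: "w = v # vs" "vs \<noteq> []" "length vs = n - 1" "v \<in> \<Lambda>" "set vs \<subseteq> \<Lambda>"
      using assms(2) by (cases w) fastforce+
    have "X v \<in> (free_lie_part \<Lambda> 1 :: ('a, 'b) free_alg set)"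
      using cval_in_free_lie_part[of "Var v" \<Lambda>] * by simp
    moreover have "?t w \<in> free_lie_part \<Lambda> (n - 1)"
      using cval_in_free_lie_part[of "right_nest (map Var vs)" \<Lambda>] *
      by (simp add: var_mset_right_nest)
    ultimately show ?thesis
      using keys_scale[of "Poly_Mapping.lookup P w" "pure (X (hd w)) (?t w)"] *
      by (auto simp: pure_def split: if_splits)
  qed
  then have "Poly_Mapping.keys (\<Sum>w \<in> Poly_Mapping.keys P. ?f w)
      \<subseteq> free_lie_part \<Lambda> 1 \<times> free_lie_part \<Lambda> (n - 1)"
    by (intro subset_trans[OF Poly_Mapping.keys_sum] UN_least)
  then show ?thesis
    unfolding deltaL_def tensor_product_def tensor_class_def
    by (intro quotientI CollectI) (rule subset_trans[OF keys_scale])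
qed

end

theory Submission
  imports Defs
begin

text \<open>
  Grouping the words of \<open>M\<close> by their first letter \<open>X\<^sub>v\<close> and writing
  \<open>M = (-1)\<^sup>l[[\<dots>[X\<^sub>v, N\<^sub>1], \<dots>], N\<^sub>s]\<close>, only the words of \<open>(-1)\<^sup>lX\<^sub>vN\<^sub>1\<dots>N\<^sub>s\<close> begin with
  \<open>X\<^sub>v\<close>, since \<open>X\<^sub>v\<close> does not occur in the \<open>N\<^sub>i\<close>. Right-nested bracketing \<open>\<rho>\<close> sends \<open>NQ\<close> to \<open>[N, \<rho>(Q)]\<close>
  for Lie elements \<open>N\<close>, and \<open>\<rho>(N\<^sub>s) = (deg N\<^sub>s)N\<^sub>s\<close> by Dynkin, Specht and Wever; so the
  second tensor factor at \<open>X\<^sub>v\<close> is \<open>(deg N\<^sub>s)(-1)\<^sup>l[N\<^sub>1, [\<dots>, N\<^sub>s]\<dots>]\<close>, and \<open>deg N\<^sub>s\<close> is the co-weight.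
\<close>

section \<open>Linear extension from words\<close>

definition lin_ext :: "('i \<Rightarrow> ('j \<Rightarrow>\<^sub>0 'k)) \<Rightarrow> ('i \<Rightarrow>\<^sub>0 'k::comm_ring_1) \<Rightarrow> ('j \<Rightarrow>\<^sub>0 'k)" where
  "lin_ext f P = (\<Sum>w \<in> Poly_Mapping.keys P. scale (Poly_Mapping.lookup P w) (f w))"

abbreviation linear_map :: "(('i \<Rightarrow>\<^sub>0 'k::comm_ring_1) \<Rightarrow> ('j \<Rightarrow>\<^sub>0 'k)) \<Rightarrow> bool" where
  "linear_map \<equiv> module_hom scale scale"

lemma linear_mapI:
  assumes "\<And>P Q. T (P + Q) = T P + T Q" "\<And>c P. T (scale c P) = scale c (T P)"
  shows "linear_map T"
  using assms by unfold_locales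

text \<open>Extra words carry coefficient 0. The supports of \<open>P\<close>, \<open>Q\<close> and
  \<open>P + Q\<close> differ, so additivity is checked on sums over one common set.\<close>

lemma lin_ext_superset:
  assumes "finite S" "Poly_Mapping.keys P \<subseteq> S"
  shows "lin_ext f P = (\<Sum>w \<in> S. scale (Poly_Mapping.lookup P w) (f w))"
  unfolding lin_ext_def by (rule sum.mono_neutral_left) (use assms in \<open>auto simp: in_keys_iff\<close>)

lemma linear_map_lin_ext:
  fixes f :: "'i \<Rightarrow> ('j \<Rightarrow>\<^sub>0 'k::comm_ring_1)"
  shows "linear_map (lin_ext f)"
proof (rule linear_mapI)
  fix P Q :: "'i \<Rightarrow>\<^sub>0 'k"
  let ?S = "Poly_Mapping.keys P \<union> Poly_Mapping.keys Q"
  have "Poly_Mapping.keys (P + Q) \<subseteq> ?S" by (rule Poly_Mapping.keys_add)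
  then show "lin_ext f (P + Q) = lin_ext f P + lin_ext f Q"
    by (simp add: lin_ext_superset[of ?S] lookup_add free_mod.scale_left_distrib sum.distrib)
next
  fix c and P :: "'i \<Rightarrow>\<^sub>0 'k"
  show "lin_ext f (scale c P) = scale c (lin_ext f P)"
    by (simp add: lin_ext_superset[of "Poly_Mapping.keys P"] keys_scale free_mod.scale_sum_right)
qed

lemma lin_ext_single [simp]: "lin_ext f (Poly_Mapping.single w 1) = f w"
  by (simp add: lin_ext_def)

lemma poly_mapping_expansion:
  "P = (\<Sum>w \<in> Poly_Mapping.keys P. scale (Poly_Mapping.lookup P w) (Poly_Mapping.single w 1))"
  by (rule poly_mapping_eqI)
     (simp add: lookup_sum lookup_single when_def in_keys_iff if_distrib[of "(*) _"] cong: if_cong)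

lemma linear_map_eqI:
  assumes "linear_map S" "linear_map T"
    and "\<And>w. w \<in> Poly_Mapping.keys P \<Longrightarrow> S (Poly_Mapping.single w 1) = T (Poly_Mapping.single w 1)"
  shows "S P = T P"
proof -
  interpret S: module_hom scale scale S by fact
  interpret T: module_hom scale scale T by fact
  show ?thesis
    by (subst (1 2) poly_mapping_expansion) (simp add: S.sum T.sum S.scale T.scale assms(3))
qed

lemma linear_map_compose: "linear_map S \<Longrightarrow> linear_map T \<Longrightarrow> linear_map (\<lambda>P. S (T P))"
  using module_hom_compose[of scale scale T scale S] by (simp add: o_def)

section \<open>Bilinearity of the product and of the bracket\<close>

lemma scale_eq_times: "scale c P = Poly_Mapping.single [] c * P"
  for P :: "('v, 'k::comm_ring_1) free_alg"
  unfolding scale_def by (simp add: mult_map_scale_conv_mult zero_list_def)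

lemma scale_mult_left: "scale c P * Q = scale c (P * Q)"
  for P :: "('v, 'k::comm_ring_1) free_alg"
  by (simp add: scale_eq_times mult.assoc)

text \<open>Constants sit at the empty word, which commutes with every word, so they are
  central.\<close>

lemma scale_mult_right: "P * scale c Q = scale c (P * Q)"
  for P :: "('v, 'k::comm_ring_1) free_alg"
proof -
  have "P * Poly_Mapping.single [] c = Poly_Mapping.single [] c * P"
  proof -
    have 1: "Poly_Mapping.single w a * Poly_Mapping.single [] c =
        Poly_Mapping.single [] c * Poly_Mapping.single w a" for w :: "'v list" and a
      by (simp add: mult_single plus_list_def mult.commute)
    have "scale a (Poly_Mapping.single w 1) = Poly_Mapping.single w a" for w :: "'v list" and a :: 'k
      by (simp add: scale_eq_times mult_single plus_list_def)
    then show ?thesis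
      by (subst (1 2) poly_mapping_expansion) (simp add: sum_distrib_left sum_distrib_right 1)
  qed
  then show ?thesis by (simp add: scale_eq_times flip: mult.assoc)
qed

lemma linear_map_mult_right: "linear_map (\<lambda>P. P * Q)"
  for Q :: "('v, 'k::comm_ring_1) free_alg"
  by (rule linear_mapI) (simp_all add: distrib_right scale_mult_left)

lemma linear_map_mult_left: "linear_map (\<lambda>P. Q * P)"
  for Q :: "('v, 'k::comm_ring_1) free_alg"
  by (rule linear_mapI) (simp_all add: distrib_left scale_mult_right)

lemma linear_map_bracket: "linear_map (bracket P)"
  by (rule linear_mapI)
     (simp_all add: bracket_def distrib_left distrib_right scale_mult_left scale_mult_right
       free_mod.scale_right_diff_distrib)

lemma bracket_jacobi: "bracket (bracket A B) Y = bracket A (bracket B Y) - bracket B (bracket A Y)"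
  by (simp add: bracket_def algebra_simps)

lemma Nil_notin_keys_cval: "[] \<notin> Poly_Mapping.keys (cval M :: ('v, 'k::comm_ring_1) free_alg)"
proof -
  have "cdeg M \<noteq> 0" by (induction M) simp_all
  then show ?thesis
    using cval_in_free_lie_part[of M UNIV, where 'k='k] by (force simp: free_lie_part_def)
qed

lemma Nil_notin_keys_mult:
  "[] \<notin> Poly_Mapping.keys Q \<Longrightarrow> [] \<notin> Poly_Mapping.keys (P * Q)"
  for P :: "('v, 'k::comm_ring_1) free_alg"
  using keys_mult[of P Q] by (auto simp: plus_list_def)

section \<open>Right-nested bracketing\<close>

text \<open>\<^term>\<open>right_nest []\<close> is unspecified, hence the case distinction.\<close>

definition dynkin_word :: "'v list \<Rightarrow> ('v, 'k::comm_ring_1) free_alg" where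
  "dynkin_word w = (if w = [] then 0 else cval (right_nest (map Var w)))"

abbreviation dynkin :: "('v, 'k::comm_ring_1) free_alg \<Rightarrow> ('v, 'k) free_alg" where
  "dynkin \<equiv> lin_ext dynkin_word"

interpretation dynkin: module_hom scale scale dynkin
  by (rule linear_map_lin_ext)

lemma single_mult_words:
  "Poly_Mapping.single u 1 * Poly_Mapping.single w 1 =
    (Poly_Mapping.single (u @ w) 1 :: ('v, 'k::comm_ring_1) free_alg)"
  by (simp add: mult_single plus_list_def)

text \<open>The empty word is excluded: \<open>X v\<close> times it is sent to \<open>X v\<close>,
  while the right-hand side would be \<open>bracket (X v) 0\<close>, hence 0.\<close>

lemma dynkin_X_mult:
  assumes "[] \<notin> Poly_Mapping.keys Q"
  shows "dynkin (X v * Q) = bracket (X v) (dynkin Q)"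
proof (rule linear_map_eqI[of "\<lambda>Q. dynkin (X v * Q)" "\<lambda>Q. bracket (X v) (dynkin Q)"])
  fix w assume "w \<in> Poly_Mapping.keys Q"
  then have "w \<noteq> []" using assms by auto
  then show "dynkin (X v * Poly_Mapping.single w 1) =
      bracket (X v) (dynkin (Poly_Mapping.single w 1))"
    by (simp add: X_def single_mult_words dynkin_word_def right_nest_Cons)
qed (rule linear_map_compose[OF linear_map_lin_ext linear_map_mult_left]
      linear_map_compose[OF linear_map_bracket linear_map_lin_ext])+

text \<open>Left multiplication by a Lie element turns into its adjoint action; the Jacobi identity
  passes this on to commutators. \<open>Q\<close> varies since \<open>cval B * Q\<close> takes its
  place.\<close>

lemma dynkin_cval_mult:
  assumes "[] \<notin> Poly_Mapping.keys Q"
  shows "dynkin (cval N * Q) = bracket (cval N) (dynkin Q)"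
  using assms
proof (induction N arbitrary: Q)
  case (Comm A B)
  have "dynkin (cval (Comm A B) * Q) = dynkin (cval A * (cval B * Q)) - dynkin (cval B * (cval A * Q))"
    by (simp add: bracket_def left_diff_distrib mult.assoc dynkin.diff)
  also have "\<dots> = bracket (cval (Comm A B)) (dynkin Q)"
    using Comm by (simp add: Nil_notin_keys_mult bracket_jacobi)
  finally show ?case .
qed (simp_all add: dynkin_X_mult dynkin.neg bracket_minus)

text \<open>The theorem of Dynkin, Specht and Wever.\<close>

lemma dynkin_cval: "dynkin (cval N) = scale (of_nat (cdeg N)) (cval N)"
proof (induction N)
  case (Comm A B)
  let ?A = "cval A :: ('a, 'b) free_alg" and ?B = "cval B :: ('a, 'b) free_alg"
  \<comment> \<open>In each product the left factor acts on the right one, so each term contributes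
    one degree; antisymmetry then adds the two.\<close>
  have "dynkin (bracket ?A ?B) = bracket ?A (dynkin ?B) - bracket ?B (dynkin ?A)"
    unfolding bracket_def[of ?A ?B] dynkin.diff
    by (simp only: dynkin_cval_mult[OF Nil_notin_keys_cval])
  also have "\<dots> = scale (of_nat (cdeg B)) (bracket ?A ?B) - scale (of_nat (cdeg A)) (bracket ?B ?A)"
    by (simp only: Comm module_hom.scale[OF linear_map_bracket])
  also have "bracket ?B ?A = - bracket ?A ?B"
    by (rule bracket_switch)
  finally show ?case
    by (simp add: free_mod.scale_left_distrib add.commute)
next
  case (Var v)
  then show ?case by (simp add: X_def dynkin_word_def)
next
  case (Neg N)
  then show ?case by (simp add: dynkin.neg)
qed

section \<open>Stripping the first letter\<close>

definition strip_word :: "'v \<Rightarrow> 'v list \<Rightarrow> ('v, 'k::comm_ring_1) free_alg" where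
  "strip_word v w = (if w \<noteq> [] \<and> hd w = v then Poly_Mapping.single (tl w) 1 else 0)"

abbreviation strip :: "'v \<Rightarrow> ('v, 'k::comm_ring_1) free_alg \<Rightarrow> ('v, 'k) free_alg" where
  "strip v \<equiv> lin_ext (strip_word v)"

interpretation strip: module_hom scale scale "strip v"
  by (rule linear_map_lin_ext)

text \<open>A nonempty left word supplies the first letter of a product; linearity in
  \<open>P\<close> and then in \<open>Q\<close> reduces to words.\<close>

lemma strip_mult:
  assumes "[] \<notin> Poly_Mapping.keys P"
  shows "strip v (P * Q) = strip v P * Q"
proof (rule linear_map_eqI[of "\<lambda>P. strip v (P * Q)" "\<lambda>P. strip v P * Q"])
  fix u assume "u \<in> Poly_Mapping.keys P"
  then have u: "u \<noteq> []" using assms by auto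
  show "strip v (Poly_Mapping.single u 1 * Q) = strip v (Poly_Mapping.single u 1) * Q"
  proof (rule linear_map_eqI[of "\<lambda>Q. strip v (Poly_Mapping.single u 1 * Q)"
        "\<lambda>Q. strip v (Poly_Mapping.single u 1) * Q"])
    show "strip v (Poly_Mapping.single u 1 * Poly_Mapping.single w 1) =
        strip v (Poly_Mapping.single u 1) * Poly_Mapping.single w 1" for w
      using u by (simp add: single_mult_words strip_word_def)
  qed (rule linear_map_compose[OF linear_map_lin_ext linear_map_mult_left] linear_map_mult_left)+
qed (rule linear_map_compose[OF linear_map_lin_ext linear_map_mult_right]
      linear_map_compose[OF linear_map_mult_right linear_map_lin_ext])+

lemma strip_cval_0: "v \<notin># var_mset M \<Longrightarrow> strip v (cval M) = 0"
  by (induction M)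
     (simp_all add: X_def strip_word_def strip.neg bracket_def strip.diff strip_mult
       Nil_notin_keys_cval)

text \<open>Each term of \<open>MN - NM\<close> is stripped in its left factor, and the factor
  without \<open>v\<close> is killed.\<close>

lemma strip_cval_Comm:
  assumes "count (var_mset (Comm M N)) v = 1"
  shows "strip v (cval (Comm M N)) =
    (if v \<in># var_mset M then strip v (cval M) * cval N else - (strip v (cval N) * cval M))"
  using assms
  by (auto simp: bracket_def strip.diff strip_mult Nil_notin_keys_cval strip_cval_0 not_in_iff
      simp flip: count_greater_zero_iff)

lemma count_Comm_eq_1:
  assumes "count (var_mset (Comm M N)) v = 1"
  shows "v \<in># var_mset M \<Longrightarrow> count (var_mset M) v = 1"
    and "v \<notin># var_mset M \<Longrightarrow> count (var_mset N) v = 1"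
  using assms by (auto simp: not_in_iff simp flip: count_greater_zero_iff)

text \<open>
  If \<open>M = (-1)\<^sup>l[[\<dots>[X\<^sub>v, N\<^sub>1], \<dots>], N\<^sub>s]\<close>, then \<open>strip v M = (-1)\<^sup>lN\<^sub>1\<dots>N\<^sub>s\<close>, and left factors that
  are Lie elements act on \<^const>\<open>dynkin\<close> through the adjoint representation.
\<close>

lemma dynkin_strip_mult:
  assumes "count (var_mset M) v = 1" "[] \<notin> Poly_Mapping.keys Y"
  shows "dynkin (strip v (cval M) * Y) = rem_tail v M (dynkin Y)"
  using assms
proof (induction M arbitrary: Y)
  case (Var u)
  then have "strip v (cval (Var u)) = (1 :: ('a, 'b) free_alg)"
    by (simp add: X_def strip_word_def zero_list_def flip: single_one split: if_splits)
  then show ?case by simp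
next
  case (Neg M)
  then show ?case by (simp add: strip.neg dynkin.neg)
next
  case (Comm M N)
  note count = count_Comm_eq_1[OF Comm.prems(1)]
  \<comment> \<open>Associativity absorbs the sibling of the entry containing \<open>v\<close> into
    \<open>Y\<close>, matching the recursion of \<open>rem_tail\<close>.\<close>
  show ?case
    using Comm.prems(2)
    by (simp add: strip_cval_Comm[OF Comm.prems(1)] mult.assoc dynkin.neg
        Comm.IH count Nil_notin_keys_mult dynkin_cval_mult del: cval.simps)
qed

lemma linear_map_rem_tail:
  "linear_map (rem_tail v M :: ('v, 'k::comm_ring_1) free_alg \<Rightarrow> ('v, 'k) free_alg)"
proof (rule linear_mapI)
  have br: "bracket P (Y + Z) = bracket P Y + bracket P Z" "bracket P (scale c Y) = scale c (bracket P Y)"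
    for P Y Z :: "('v, 'k) free_alg" and c
    using linear_map_bracket[of P] by (simp_all add: module_hom.add module_hom.scale)
  show "rem_tail v M (Y + Z) = rem_tail v M Y + rem_tail v M Z"
    for Y Z :: "('v, 'k) free_alg"
    by (induction M arbitrary: Y Z) (simp_all add: br)
  show "rem_tail v M (scale c Y) = scale c (rem_tail v M Y)"
    for c and Y :: "('v, 'k) free_alg"
    by (induction M arbitrary: Y) (simp_all add: br)
qed

text \<open>The outermost commutator supplies the last factor, which \<open>dynkin_cval\<close>
  multiplies by its degree. That degree is the co-weight, and linearity of \<open>rem_tail\<close>
  moves it outside.\<close>

lemma dynkin_strip_cval:
  assumes "count (var_mset M) v = 1"
  shows "dynkin (strip v (cval M)) = scale (of_nat (cw v M)) (rem_rec v M)"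
  using assms
proof (induction M)
  case (Var u)
  \<comment> \<open>At most the empty word is left, where \<open>dynkin_word\<close> is 0 by
    convention; this matches co-weight 0.\<close>
  have "dynkin (strip v (X u)) = 0"
    using dynkin.zero by (simp add: X_def strip_word_def) (simp add: dynkin_word_def)
  then show ?case by simp
next
  case (Neg M)
  then show ?case by (simp add: strip.neg dynkin.neg)
next
  case (Comm M N)
  note count = count_Comm_eq_1[OF Comm.prems(1)]
  show ?case
    by (simp add: strip_cval_Comm[OF Comm.prems(1)] dynkin.neg dynkin_strip_mult count
        Nil_notin_keys_cval dynkin_cval module_hom.scale[OF linear_map_rem_tail] del: cval.simps)
qed

section \<open>Degree and recursive value of the remainder\<close>

lemma var_mset_left_nest:
  "Ns \<noteq> [] \<Longrightarrow> var_mset (left_nest L Ns) = var_mset L + var_mset (right_nest Ns)"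
proof (induction Ns arbitrary: L)
  case (Cons N Ns)
  then show ?case by (cases "Ns = []") (simp_all add: left_nest_def right_nest_Cons)
qed simp

text \<open>As \<open>remL\<close> is a definite description, membership is read off from a chosen
  left-nested form: dropping the innermost \<open>v\<close> lowers the degree by 1.\<close>

lemma remL_in_free_lie_part:
  assumes "count (var_mset M) v = 1" "cdeg M \<ge> 2" "set_mset (var_mset M) \<subseteq> \<Lambda>"
  shows "remL v M \<in> free_lie_part \<Lambda> (cdeg M - 1)"
proof -
  obtain l Ns where *: "Ns \<noteq> []" "switch_eq M ((Neg ^^ l) (left_nest (Var v) Ns))"
    using assms(1,2) by (rule remL_witness)
  have pow: "var_mset ((Neg ^^ l) L) = var_mset L" for L :: "'a cmon"
    by (induction l) simp_all
  have "var_mset M = {#v#} + var_mset ((Neg ^^ l) (right_nest Ns))"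
    using switch_eq_var_mset[OF *(2)] by (simp add: pow var_mset_left_nest[OF *(1)])
  then show ?thesis
    using cval_in_free_lie_part[of "(Neg ^^ l) (right_nest Ns)" \<Lambda>] assms(3)
    by (simp add: remL_eqI[OF assms(1) *])
qed

lemma remL_eq_rem_rec:
  assumes "count (var_mset M) v = 1" "cdeg M \<ge> 2"
  shows "remL v M = rem_rec v M"
proof -
  obtain l Ns where "Ns \<noteq> []" "switch_eq M ((Neg ^^ l) (left_nest (Var v) Ns))"
    using assms by (rule remL_witness)
  with assms(1) show ?thesis
    by (simp add: remL_eqI switch_eq_rem_rec rem_rec_left_nest)
qed

section \<open>Computing with tensors\<close>

lemma subspace_free_lie_part: "free_mod.subspace (free_lie_part \<Lambda> n)"
proof (rule free_mod.subspaceI)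
  show "P + Q \<in> free_lie_part \<Lambda> n" if "P \<in> free_lie_part \<Lambda> n" "Q \<in> free_lie_part \<Lambda> n" for P Q
    using that Poly_Mapping.keys_add[of P Q] by (auto simp: free_lie_part_def intro: free_lie.add)
  show "scale c P \<in> free_lie_part \<Lambda> n" if "P \<in> free_lie_part \<Lambda> n" for c P
    using that keys_scale[of c P] by (auto simp: free_lie_part_def intro: free_lie.scale)
qed (simp add: free_lie_part_def free_lie.zero)

lemma pure_add_right:
  "a \<in> A \<Longrightarrow> b \<in> B \<Longrightarrow> b' \<in> B \<Longrightarrow> pure a (b + b') - pure a b - pure a b' \<in> tensor_relations A B"
  unfolding tensor_relations_def by (rule free_mod.span_base) blast

lemma pure_scale_right:
  "a \<in> A \<Longrightarrow> b \<in> B \<Longrightarrow> pure a (scale c b) - scale c (pure a b) \<in> tensor_relations A B"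
  unfolding tensor_relations_def by (rule free_mod.span_base) blast

lemma subspace_tensor_relations: "free_mod.subspace (tensor_relations A B)"
  unfolding tensor_relations_def by (rule free_mod.subspace_span)

lemma pure_sum_scale_right:
  assumes "finite S" "free_mod.subspace B" "a \<in> A" "\<And>i. i \<in> S \<Longrightarrow> b i \<in> B"
  shows "pure a (\<Sum>i\<in>S. scale (c i) (b i)) - (\<Sum>i\<in>S. scale (c i) (pure a (b i))) \<in> tensor_relations A B"
  using assms(1,4)
proof (induction S)
  case empty
  \<comment> \<open>\<open>pure a 0\<close> is a generator of the free module, not literally 0; it
    becomes a relation through the scalar 0.\<close>
  show ?case
    using pure_scale_right[of a A 0 B 0] assms(2,3) by (simp add: free_mod.subspace_0)
next
  case (insert i S)
  let ?b = "\<Sum>i\<in>S. scale (c i) (b i)"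
  let ?t = "\<Sum>i\<in>S. scale (c i) (pure a (b i))"
  have b: "b i \<in> B" "scale (c i) (b i) \<in> B" "?b \<in> B"
    using insert.prems assms(2) by (auto intro: free_mod.subspace_scale free_mod.subspace_sum)
  \<comment> \<open>An additivity relation, a scaling relation and the induction hypothesis
    telescope to the required difference.\<close>
  have "(pure a (scale (c i) (b i) + ?b) - pure a (scale (c i) (b i)) - pure a ?b) +
      ((pure a (scale (c i) (b i)) - scale (c i) (pure a (b i))) + (pure a ?b - ?t)) \<in> tensor_relations A B"
    by (intro free_mod.subspace_add[OF subspace_tensor_relations] pure_add_right pure_scale_right
        insert.IH) (use assms(3) b insert.prems in auto)
  then show ?case using insert.hyps by (simp add: algebra_simps)
qed

lemma tensor_class_eqI:
  assumes "Poly_Mapping.keys f \<subseteq> A \<times> B" "Poly_Mapping.keys g \<subseteq> A \<times> B"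
    and "f - g \<in> tensor_relations A B"
  shows "tensor_class A B f = tensor_class A B g"
proof -
  have "f - h \<in> tensor_relations A B \<longleftrightarrow> g - h \<in> tensor_relations A B" for h
    using free_mod.subspace_add[OF subspace_tensor_relations, of "f - g" A B "g - h"]
      free_mod.subspace_diff[OF subspace_tensor_relations, of "f - h" A B "f - g"] assms(3)
    by auto
  then show ?thesis
    using assms(1,2) by (auto simp: tensor_class_def tensor_congruence_def)
qed

lemma subspace_keys:
  "free_mod.subspace {f :: 'i \<Rightarrow>\<^sub>0 'k::comm_ring_1. Poly_Mapping.keys f \<subseteq> S}"
proof (rule free_mod.subspaceI)
  show "f + g \<in> {f. Poly_Mapping.keys f \<subseteq> S}"
    if "f \<in> {f. Poly_Mapping.keys f \<subseteq> S}" "g \<in> {f. Poly_Mapping.keys f \<subseteq> S}"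
    for f g :: "'i \<Rightarrow>\<^sub>0 'k"
    using that Poly_Mapping.keys_add[of f g] by blast
  show "scale c f \<in> {f. Poly_Mapping.keys f \<subseteq> S}" if "f \<in> {f. Poly_Mapping.keys f \<subseteq> S}"
    for c and f :: "'i \<Rightarrow>\<^sub>0 'k"
    using that keys_scale[of c f] by blast
qed simp

text \<open>Stripping causes no cancellation, since a word starting with \<open>v\<close> is
  determined by its tail.\<close>

lemma lookup_strip: "Poly_Mapping.lookup (strip v P) u = Poly_Mapping.lookup P (v # u)"
proof -
  have "Poly_Mapping.lookup (strip v P) u =
      (\<Sum>w \<in> Poly_Mapping.keys P. if w = v # u then Poly_Mapping.lookup P w else 0)"
    unfolding lin_ext_def lookup_sum
    by (rule sum.cong) (auto simp: strip_word_def lookup_single when_def neq_Nil_conv)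
  then show ?thesis by (simp add: in_keys_iff)
qed

text \<open>By \<open>lookup_strip\<close>, \<open>tl\<close> and prefixing \<open>v\<close> are
  inverse bijections between the words of \<open>P\<close> starting with \<open>v\<close> and the
  support of \<open>strip v P\<close>.\<close>

lemma sum_keys_by_head:
  fixes P :: "('v, 'k::comm_ring_1) free_alg"
  assumes "finite S" "\<And>w. w \<in> Poly_Mapping.keys P \<Longrightarrow> w \<noteq> [] \<and> hd w \<in> S"
  shows "(\<Sum>w \<in> Poly_Mapping.keys P. g w) =
    (\<Sum>v \<in> S. \<Sum>u \<in> Poly_Mapping.keys (strip v P). g (v # u))"
proof -
  have "(\<Sum>w \<in> Poly_Mapping.keys P. g w) =
      (\<Sum>v \<in> S. sum g {w \<in> Poly_Mapping.keys P. hd w = v})"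
    by (rule sum.group[symmetric]) (use assms in auto)
  also have "\<dots> = (\<Sum>v \<in> S. \<Sum>u \<in> Poly_Mapping.keys (strip v P). g (v # u))"
  proof (rule sum.cong[OF HOL.refl])
    fix v
    show "sum g {w \<in> Poly_Mapping.keys P. hd w = v} =
        (\<Sum>u \<in> Poly_Mapping.keys (strip v P). g (v # u))"
      by (rule sum.reindex_bij_witness[of _ "\<lambda>u. v # u" tl])
         (use assms(2) in \<open>auto simp: in_keys_iff lookup_strip\<close>)
  qed
  finally show ?thesis .
qed

theorem theorem4p1:
  fixes \<iota> :: "rat \<Rightarrow> 'k::comm_ring_1"
    and \<Lambda> :: "'v set"
    and x :: "nat \<Rightarrow> 'v"
    and M :: "'v cmon"
    and n :: nat
  assumes "rat_embedding \<iota>"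
    and "n \<ge> 2"
    and "inj_on x {1..n}"
    and "x ` {1..n} \<subseteq> \<Lambda>"
    and "var_mset M = mset_set (x ` {1..n})"
  shows "deltaL \<Lambda> \<iota> n (cval M) =
    tensor_class (free_lie_part \<Lambda> 1) (free_lie_part \<Lambda> (n - 1))
      (scale (\<iota> (1 / of_nat n))
        (\<Sum>k = 1..n. scale (of_nat (cw (x k) M)) (pure (X (x k)) (remL (x k) M))))"
proof -
  let ?A = "free_lie_part \<Lambda> 1 :: ('v, 'k) free_alg set"
  let ?B = "free_lie_part \<Lambda> (n - 1) :: ('v, 'k) free_alg set"
  let ?P = "cval M :: ('v, 'k) free_alg"
  let ?R = "\<lambda>v. remL v M :: ('v, 'k) free_alg"
  let ?S = "x ` {1..n}"
  let ?t = "\<lambda>v u. scale (Poly_Mapping.lookup (strip v ?P) u) (pure (X v) (dynkin_word u))"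
  have deg: "cdeg M = n" using assms(3,5) by (simp add: card_image)
  have count: "count (var_mset M) v = 1" if "v \<in> ?S" for v
    using that assms(5) by (simp add: count_mset_set)
  \<comment> \<open>Taking the variables of \<open>M\<close> as alphabet, instead of all of
    \<Lambda>, confines first letters to \<open>?S\<close>.\<close>
  have P: "?P \<in> free_lie_part ?S n"
    using cval_in_free_lie_part[of M ?S] assms(5) deg by simp
  have word: "length w = n" "set w \<subseteq> ?S" if "w \<in> Poly_Mapping.keys ?P" for w
    using that P free_lie_words[of ?P ?S w] by (auto simp: free_lie_part_def)
  have XA: "X v \<in> ?A" if "v \<in> ?S" for v
    using cval_in_free_lie_part[of "Var v" \<Lambda>] that assms(4) by auto
  have dynkin_B: "dynkin_word u \<in> ?B" and u: "u \<noteq> []"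
    if "u \<in> Poly_Mapping.keys (strip v ?P)" for u v
  proof -
    \<comment> \<open>As \<open>n\<close> is at least 2, the tail \<open>u\<close> is nonempty and
      \<open>dynkin_word u\<close> is a genuine nested commutator of degree
      \<open>n - 1\<close>.\<close>
    have vu: "length (v # u) = n" "set (v # u) \<subseteq> ?S"
      using that word[of "v # u"] by (simp_all add: in_keys_iff lookup_strip)
    then show "u \<noteq> []" using assms(2) by auto
    moreover have "set u \<subseteq> \<Lambda>" using vu assms(4) by auto
    ultimately show "dynkin_word u \<in> ?B"
      using cval_in_free_lie_part[of "right_nest (map Var u)" \<Lambda>] vu
      by (auto simp: var_mset_right_nest dynkin_word_def)
  qed
  have rem: "dynkin (strip v ?P) = scale (of_nat (cw v M)) (?R v)" if "v \<in> ?S" for v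
    using that assms(2) count deg by (simp add: dynkin_strip_cval remL_eq_rem_rec)
  have remB: "?R v \<in> ?B" if "v \<in> ?S" for v
    using remL_in_free_lie_part[of M v \<Lambda>] that assms(2,4,5) count deg by simp
  let ?f = "\<Sum>v \<in> ?S. \<Sum>u \<in> Poly_Mapping.keys (strip v ?P). ?t v u"
  let ?g = "\<Sum>v \<in> ?S. scale (of_nat (cw v M)) (pure (X v) (?R v))"
  have sum_eq: "(\<Sum>w \<in> Poly_Mapping.keys ?P. scale (Poly_Mapping.lookup ?P w)
      (pure (X (hd w)) (cval (right_nest (map Var (tl w)))))) = ?f"
  proof (subst sum_keys_by_head[of ?S])
    show "w \<noteq> [] \<and> hd w \<in> ?S" if "w \<in> Poly_Mapping.keys ?P" for w
      using word[OF that] assms(2) by (cases w) auto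
  qed (use u in \<open>auto simp: lookup_strip dynkin_word_def intro!: sum.cong\<close>)
  have "?f - ?g = (\<Sum>v \<in> ?S. (\<Sum>u \<in> Poly_Mapping.keys (strip v ?P). ?t v u)
      - scale (of_nat (cw v M)) (pure (X v) (?R v)))"
    by (simp add: sum_subtractf)
  also have "\<dots> \<in> tensor_relations ?A ?B"
  proof (rule free_mod.subspace_sum[OF subspace_tensor_relations])
    fix v assume v: "v \<in> ?S"
    have "pure (X v) (dynkin (strip v ?P)) - (\<Sum>u \<in> Poly_Mapping.keys (strip v ?P). ?t v u)
        \<in> tensor_relations ?A ?B"
      unfolding lin_ext_def[of dynkin_word]
      by (rule pure_sum_scale_right) (use XA v dynkin_B subspace_free_lie_part in auto)
    \<comment> \<open>By \<open>rem\<close>, both relations contain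
      \<open>pure (X v) (dynkin (strip v ?P))\<close>, which cancels in their difference.\<close>
    from free_mod.subspace_diff[OF subspace_tensor_relations
        pure_scale_right[OF XA[OF v] remB[OF v], of "of_nat (cw v M)"] this]
    show "(\<Sum>u \<in> Poly_Mapping.keys (strip v ?P). ?t v u)
        - scale (of_nat (cw v M)) (pure (X v) (?R v)) \<in> tensor_relations ?A ?B"
      by (simp add: rem[OF v])
  qed
  finally have rel: "?f - ?g \<in> tensor_relations ?A ?B" .
  have keys: "scale c (pure (X v) b) \<in> {f. Poly_Mapping.keys f \<subseteq> ?A \<times> ?B}"
    if "v \<in> ?S" "b \<in> ?B" for c v b
    by (rule free_mod.subspace_scale[OF subspace_keys]) (use XA that in \<open>auto simp: pure_def\<close>)
  have "?f \<in> {f. Poly_Mapping.keys f \<subseteq> ?A \<times> ?B}" "?g \<in> {f. Poly_Mapping.keys f \<subseteq> ?A \<times> ?B}"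
    by (intro free_mod.subspace_sum[OF subspace_keys] keys dynkin_B remB; assumption)+
  \<comment> \<open>Supports and relations are stable under scaling, which brings in the factor
    1/n.\<close>
  then have "tensor_class ?A ?B (scale c ?f) = tensor_class ?A ?B (scale c ?g)" for c
    using free_mod.subspace_scale[OF subspace_keys]
      free_mod.subspace_scale[OF subspace_tensor_relations rel]
    by (intro tensor_class_eqI) (fastforce simp: free_mod.scale_right_diff_distrib)+
  moreover have "?g = (\<Sum>k = 1..n. scale (of_nat (cw (x k) M)) (pure (X (x k)) (?R (x k))))"
    by (simp only: sum.reindex[OF assms(3)] o_def)
  ultimately show ?thesis
    unfolding deltaL_def sum_eq by simp
qed

end
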